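(* Let $\mathcal{X}$ be a non-empty finite set, $N\geq1$ an integer, and $\mathcal{A}\subseteq\mathcal{G}(\mathcal{X}^N)$ a set of gambles on $\mathcal{X}^N$. Then: (i) $\mathcal{A}$ avoids non-positivity under exchangeability if and only if $\mathrm{Hy}^N(\mathcal{A})$ avoids non-positivity; (ii) $\mathrm{Hy}^N\bigl(\mathcal{E}_{\mathrm{ex}}^N(\mathcal{A})\bigr)=\mathcal{E}\bigl(\mathrm{Hy}^N(\mathcal{A})\bigr)$.
   Context: A gamble on a non-empty set $\Omega$ is a bounded function $\Omega\to\mathbb{R}$; $\mathcal{G}(\Omega)$ is the linear space of all gambles on $\Omega$. Write $f\geq g$ for the pointwise ordering, and $f>g$ iff $f\geq g$ and $f\neq g$; $\mathcal{G}^+_0(\Omega)=\{f:f>0\}$. For $\mathcal{A}\subseteq\mathcal{G}(\Omega)$, $\mathrm{posi}(\mathcal{A})=\{\sum_{k=1}^n\lambda_kf_k:n\geq1,f_k\in\mathcal{A},\lambda_k>0\}$. $\mathcal{A}$ avoids non-positivity if no $f\in\mathrm{posi}(\mathcal{A})$ satisfies $f\leq0$. A set $\mathcal{R}\subseteq\mathcal{G}(\Omega)$ is coherent if: $0\notin\mathcal{R}$; $f>0$ implies $f\in\mathcal{R}$; $f\in\mathcal{R}$ and $\lambda>0$ imply $\lambda f\in\mathcal{R}$; $f_1,f_2\in\mathcal{R}$ implies $f_1+f_2\in\mathcal{R}$. The natural extension $\mathcal{E}(\mathcal{A})$ is the intersection of all coherent subsets of $\mathcal{G}(\Omega)$ that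 include $\mathcal{A}$. Intersections of an empty collection of sets of gambles on $\Omega$ are taken to be $\mathcal{G}(\Omega)$. Let $\mathcal{P}_N$ be the set of permutations $\pi$ of $\{1,\dots,N\}$; put $\pi(x_1,\dots,x_N)=(x_{\pi(1)},\dots,x_{\pi(N)})$, $\pi^tf=f\circ\pi$, and $\mathrm{ex}^N(f)=\frac1{N!}\sum_{\pi\in\mathcal{P}_N}\pi^tf$. $\mathcal{D}_{\mathcal{U}_N}=\{f\in\mathcal{G}(\mathcal{X}^N):\mathrm{ex}^N(f)=0\}$. A coherent set $\mathcal{R}\subseteq\mathcal{G}(\mathcal{X}^N)$ is exchangeable if $\mathcal{D}_{\mathcal{U}_N}+\mathcal{R}\subseteq\mathcal{R}$. A set $\mathcal{A}\subseteq\mathcal{G}(\mathcal{X}^N)$ avoids non-positivity under exchangeability if $[\mathcal{G}^+_0(\mathcal{X}^N)\cup\mathcal{A}]+\mathcal{D}_{\mathcal{U}_N}$ avoids non-positivity. The exchangeable natural extension $\mathcal{E}_{\mathrm{ex}}^N(\mathcal{A})$ is the intersection of all coherent and exchangeable subsets of $\mathcal{G}(\mathcal{X}^N)$ that include $\mathcal{A}$ (equal to $\mathcal{G}(\mathcal{X}^N)$ if there are none). $\mathcal{N}^N=\{m\in\mathbb{Z}_{\geq0}^{\mathcal{X}}:\sum_zm_z=N\}$; for $m\in\mathcal{N}^N$, $[m]$ is the set of $x\in\mathcal{X}^N$ in which each $z\in\mathcal{X}$ occurs exactly $m_z$ times. $\mathrm{Hy}^N:\mathcal{G}(\mathcal{X}^N)\to\mathcal{G}(\mathcal{N}^N)$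 is given by $\mathrm{Hy}^N(f)(m)=\frac{1}{|[m]|}\sum_{y\in[m]}f(y)$, and $\mathrm{Hy}^N(\mathcal{A})$ denotes the image of the set $\mathcal{A}$. *)

theory Defs
  imports Complex_Main "HOL-Library.FuncSet" "HOL-Combinatorics.Permutations"
    "HOL-Library.Function_Algebras" "HOL-Library.Set_Algebras"
begin

text \<open>
  A gamble on a carrier set \<open>\<Omega>\<close> is represented by its extension by \<open>0\<close> to the whole type.
  This representation is unique, and for gambles on \<open>\<Omega>\<close> the library's pointwise \<open>+\<close>, \<open>0\<close>, \<open>\<le>\<close> and
  \<open><\<close> on functions, as well as the elementwise \<open>+\<close> on sets, are exactly the operations and
  relations of the space of gambles on \<open>\<Omega>\<close>; in particular, \<open>0 < f\<close> means
  \<open>f \<ge> 0\<close> pointwise and \<open>f \<noteq> 0\<close>.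
\<close>

definition gambles :: "'w set \<Rightarrow> ('w \<Rightarrow> real) set" where
  "gambles \<Omega> = {f. (\<exists>B. \<forall>w\<in>\<Omega>. \<bar>f w\<bar> \<le> B) \<and> (\<forall>w. w \<notin> \<Omega> \<longrightarrow> f w = 0)}"

definition pos_gambles :: "'w set \<Rightarrow> ('w \<Rightarrow> real) set" where
  "pos_gambles \<Omega> = {f \<in> gambles \<Omega>. 0 < f}"

definition posi :: "('w \<Rightarrow> real) set \<Rightarrow> ('w \<Rightarrow> real) set" where
  "posi A = {(\<lambda>w. \<Sum>k=1..n. l k * f k w) | (n::nat) (l :: nat \<Rightarrow> real) f.
     n \<ge> 1 \<and> (\<forall>k\<in>{1..n}. f k \<in> A \<and> l k > 0)}"

definition avoids_nonpositivity :: "('w \<Rightarrow> real) set \<Rightarrow> bool" where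
  "avoids_nonpositivity A \<longleftrightarrow> \<not> (\<exists>f\<in>posi A. f \<le> 0)"

definition coherent :: "'w set \<Rightarrow> ('w \<Rightarrow> real) set \<Rightarrow> bool" where
  "coherent \<Omega> R \<longleftrightarrow> R \<subseteq> gambles \<Omega> \<and> 0 \<notin> R \<and>
     (\<forall>f\<in>gambles \<Omega>. 0 < f \<longrightarrow> f \<in> R) \<and>
     (\<forall>f\<in>R. \<forall>l::real. l > 0 \<longrightarrow> (\<lambda>w. l * f w) \<in> R) \<and>
     (\<forall>f\<in>R. \<forall>g\<in>R. f + g \<in> R)"

text \<open>Intersecting with \<open>gambles \<Omega>\<close> makes the intersection of an empty family the space of all
  gambles on \<open>\<Omega>\<close>; it has no effect otherwise.\<close>

definition natural_extension :: "'w set \<Rightarrow> ('w \<Rightarrow> real) set \<Rightarrow> ('w \<Rightarrow> real) set" where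
  "natural_extension \<Omega> A = gambles \<Omega> \<inter> \<Inter>{R. coherent \<Omega> R \<and> A \<subseteq> R}"

definition seqs :: "'a set \<Rightarrow> nat \<Rightarrow> (nat \<Rightarrow> 'a) set" where
  "seqs X N = {1..N} \<rightarrow>\<^sub>E X"

text \<open>A permutation \<open>p\<close> of \<open>{1..N}\<close> acts on sequences by \<open>x \<mapsto> x \<circ> p\<close>. As \<open>p\<close> is the identity outside
  \<open>{1..N}\<close>, this action preserves \<open>seqs X N\<close> and its complement.\<close>

definition perm_gamble ::
  "(nat \<Rightarrow> nat) \<Rightarrow> ((nat \<Rightarrow> 'a) \<Rightarrow> real) \<Rightarrow> (nat \<Rightarrow> 'a) \<Rightarrow> real" where
  "perm_gamble p f = (\<lambda>x. f (x \<circ> p))"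

definition ex_avg :: "nat \<Rightarrow> ((nat \<Rightarrow> 'a) \<Rightarrow> real) \<Rightarrow> (nat \<Rightarrow> 'a) \<Rightarrow> real" where
  "ex_avg N f = (\<lambda>x. 1 / fact N * (\<Sum>p | p permutes {1..N}. perm_gamble p f x))"

definition DU :: "'a set \<Rightarrow> nat \<Rightarrow> ((nat \<Rightarrow> 'a) \<Rightarrow> real) set" where
  "DU X N = {f \<in> gambles (seqs X N). ex_avg N f = 0}"

definition exchangeable :: "'a set \<Rightarrow> nat \<Rightarrow> ((nat \<Rightarrow> 'a) \<Rightarrow> real) set \<Rightarrow> bool" where
  "exchangeable X N R \<longleftrightarrow> DU X N + R \<subseteq> R"

definition avoids_nonpositivity_ex ::
  "'a set \<Rightarrow> nat \<Rightarrow> ((nat \<Rightarrow> 'a) \<Rightarrow> real) set \<Rightarrow> bool" where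
  "avoids_nonpositivity_ex X N A \<longleftrightarrow>
     avoids_nonpositivity ((pos_gambles (seqs X N) \<union> A) + DU X N)"

definition ex_natural_extension ::
  "'a set \<Rightarrow> nat \<Rightarrow> ((nat \<Rightarrow> 'a) \<Rightarrow> real) set \<Rightarrow> ((nat \<Rightarrow> 'a) \<Rightarrow> real) set" where
  "ex_natural_extension X N A = gambles (seqs X N) \<inter>
     \<Inter>{R. coherent (seqs X N) R \<and> exchangeable X N R \<and> A \<subseteq> R}"

definition count_vectors :: "'a set \<Rightarrow> nat \<Rightarrow> ('a \<Rightarrow> nat) set" where
  "count_vectors X N = {m \<in> X \<rightarrow>\<^sub>E UNIV. (\<Sum>z\<in>X. m z) = N}"

definition atom :: "'a set \<Rightarrow> nat \<Rightarrow> ('a \<Rightarrow> nat) \<Rightarrow> (nat \<Rightarrow> 'a) set" where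
  "atom X N m = {x \<in> seqs X N. \<forall>z\<in>X. card {k \<in> {1..N}. x k = z} = m z}"

definition Hy :: "'a set \<Rightarrow> nat \<Rightarrow> ((nat \<Rightarrow> 'a) \<Rightarrow> real) \<Rightarrow> ('a \<Rightarrow> nat) \<Rightarrow> real" where
  "Hy X N f = (\<lambda>m. if m \<in> count_vectors X N
     then 1 / real (card (atom X N m)) * (\<Sum>y\<in>atom X N m. f y) else 0)"

end

theory Submission
  imports Defs
begin

text \<open>
  The operator \<open>Hy\<close> is a monotone linear map from the gambles on sequences to the gambles on count
  vectors; it has the monotone right inverse \<open>lift\<close>. Permutations act transitively on each atom,
  so averaging over all permutations amounts to averaging over the atom, that is, \<open>ex_avg\<close> is
  \<open>lift \<circ> Hy\<close>. Hence the kernel of \<open>Hy\<close> is \<open>DU\<close>, and taking images and preimages under \<open>Hy\<close> gives a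
  correspondence between coherent exchangeable sets of gambles on sequences and coherent sets of
  gambles on count vectors.
\<close>

text \<open>Restricting to \<open>X\<close> makes the result extensional, like the members of
  \<open>count_vectors X N\<close>, so the two can be compared as functions.\<close>

definition count_of :: "'a set \<Rightarrow> nat \<Rightarrow> (nat \<Rightarrow> 'a) \<Rightarrow> 'a \<Rightarrow> nat" where
  "count_of X N x = (\<lambda>z\<in>X. card {k \<in> {1..N}. x k = z})"

text \<open>The default 0 off \<open>seqs X N\<close> is the value that \<open>gambles\<close>
  demands outside the carrier.\<close>

definition lift :: "'a set \<Rightarrow> nat \<Rightarrow> (('a \<Rightarrow> nat) \<Rightarrow> real) \<Rightarrow> (nat \<Rightarrow> 'a) \<Rightarrow> real" where
  "lift X N g x = (if x \<in> seqs X N then g (count_of X N x) else 0)"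

section \<open>Sequences and count vectors\<close>

lemma finite_seqs: "finite X \<Longrightarrow> finite (seqs X N)"
  unfolding seqs_def by (intro finite_PiE) auto

lemma finite_atom: "finite X \<Longrightarrow> finite (atom X N m)"
  by (rule finite_subset[OF _ finite_seqs]) (auto simp: atom_def)

lemma seqs_mem: "x \<in> seqs X N \<Longrightarrow> k \<in> {1..N} \<Longrightarrow> x k \<in> X"
  unfolding seqs_def by (rule PiE_mem)

lemma seqs_undefined: "x \<in> seqs X N \<Longrightarrow> k \<notin> {1..N} \<Longrightarrow> x k = undefined"
  unfolding seqs_def by (rule PiE_arb)

lemma count_of_atom:
  assumes "x \<in> atom X N m" and "m \<in> count_vectors X N"
  shows "count_of X N x = m"
proof
  fix z
  show "count_of X N x z = m z"
    using assms by (cases "z \<in> X") (auto simp: count_of_def atom_def count_vectors_def dest: PiE_arb)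
qed

lemma mem_atom_count_of: "x \<in> seqs X N \<Longrightarrow> x \<in> atom X N (count_of X N x)"
  by (auto simp: atom_def count_of_def)

text \<open>The sets of positions holding each \<open>z\<close> partition \<open>{1..N}\<close>, so
  their sizes add up to \<open>N\<close>.\<close>

lemma count_of_mem:
  assumes "finite X" and "x \<in> seqs X N"
  shows "count_of X N x \<in> count_vectors X N"
proof -
  have "(\<Sum>z\<in>X. card {k \<in> {1..N}. x k = z}) = card (\<Union>z\<in>X. {k \<in> {1..N}. x k = z})"
    using assms(1) by (intro card_UN_disjoint[symmetric]) auto
  also have "(\<Union>z\<in>X. {k \<in> {1..N}. x k = z}) = {1..N}"
    using seqs_mem[OF assms(2)] by auto
  finally show ?thesis
    by (simp add: count_vectors_def count_of_def)
qed

text \<open>Listing the \<open>N\<close> elements of the disjoint union of the blocks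
  \<open>{..<m z}\<close> and reading off first components gives a sequence with counts
  \<open>m\<close>. This rules out division by zero in \<open>Hy\<close>.\<close>

lemma atom_nonempty:
  assumes "finite X" and "m \<in> count_vectors X N"
  shows "atom X N m \<noteq> {}"
proof -
  let ?S = "SIGMA z:X. {..<m z}"
  have "card ?S = N"
    using assms by (simp add: card_SigmaI count_vectors_def)
  then obtain h where h: "bij_betw h {1..N} ?S"
    using ex_bij_betw_nat_finite_1[of ?S] assms(1) by auto
  define x where "x = (\<lambda>k\<in>{1..N}. fst (h k))"
  have "x \<in> seqs X N"
    using bij_betwE[OF h] by (fastforce simp: x_def seqs_def)
  moreover have "card {k \<in> {1..N}. x k = z} = m z" if "z \<in> X" for z
  proof -
    have "h ` {k \<in> {1..N}. x k = z} = {z} \<times> {..<m z}"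
    proof (intro equalityI subsetI)
      fix w assume "w \<in> h ` {k \<in> {1..N}. x k = z}"
      then show "w \<in> {z} \<times> {..<m z}"
        using bij_betwE[OF h] by (force simp: x_def)
    next
      fix w assume w: "w \<in> {z} \<times> {..<m z}"
      then have "w \<in> h ` {1..N}"
        using h that by (auto simp: bij_betw_def)
      then obtain k where "k \<in> {1..N}" "w = h k"
        by auto
      then show "w \<in> h ` {k \<in> {1..N}. x k = z}"
        using w by (intro image_eqI[of _ _ k]) (auto simp: x_def)
    qed
    moreover have "inj_on h {k \<in> {1..N}. x k = z}"
      using h by (auto simp: bij_betw_def intro: inj_on_subset)
    ultimately have "card {k \<in> {1..N}. x k = z} = card ({z} \<times> {..<m z})"
      using card_image by fastforce
    then show ?thesis
      by (simp add: card_cartesian_product)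
  qed
  ultimately have "x \<in> atom X N m"
    by (simp add: atom_def)
  then show ?thesis
    by auto
qed

section \<open>Exchangeable averages\<close>

lemma comp_permutes_mem_seqs:
  assumes "p permutes {1..N}" and "x \<in> seqs X N"
  shows "x \<circ> p \<in> seqs X N"
  unfolding seqs_def
proof (rule PiE_I)
  show "(x \<circ> p) k \<in> X" if "k \<in> {1..N}" for k
    using seqs_mem[OF assms(2), of "p k"] that by (simp only: permutes_in_image[OF assms(1)] o_apply)
  show "(x \<circ> p) k = undefined" if "k \<notin> {1..N}" for k
    using seqs_undefined[OF assms(2) that] by (simp add: permutes_not_in[OF assms(1) that])
qed

lemma comp_permutes_mem_seqs_iff:
  assumes "p permutes {1..N}"
  shows "x \<circ> p \<in> seqs X N \<longleftrightarrow> x \<in> seqs X N"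
  using comp_permutes_mem_seqs[OF assms, of x]
    comp_permutes_mem_seqs[OF permutes_inv[OF assms], of "x \<circ> p"]
  by (auto simp: o_assoc[symmetric] permutes_inv_o[OF assms])

text \<open>For each \<open>z\<close>, \<open>p\<close> maps the positions where
  \<open>x \<circ> p\<close> takes the value \<open>z\<close> bijectively onto those where
  \<open>x\<close> does.\<close>

lemma comp_permutes_mem_atom:
  assumes p: "p permutes {1..N}" and x: "x \<in> atom X N m"
  shows "x \<circ> p \<in> atom X N m"
proof -
  have "card {k \<in> {1..N}. x (p k) = z} = card {k \<in> {1..N}. x k = z}" for z
  proof -
    have "p ` {k \<in> {1..N}. x (p k) = z} = {k \<in> {1..N}. x k = z}"
    proof (intro equalityI subsetI)
      fix j assume "j \<in> p ` {k \<in> {1..N}. x (p k) = z}"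
      then show "j \<in> {k \<in> {1..N}. x k = z}"
        using permutes_in_image[OF p] by auto
    next
      fix j assume j: "j \<in> {k \<in> {1..N}. x k = z}"
      then have "j \<in> p ` {1..N}"
        by (simp only: permutes_image[OF p]) simp
      then show "j \<in> p ` {k \<in> {1..N}. x (p k) = z}"
        using j by auto
    qed
    then show ?thesis
      using card_image[OF permutes_inj_on[OF p], of "{k \<in> {1..N}. x (p k) = z}"] by simp
  qed
  then show ?thesis
    using x comp_permutes_mem_seqs[OF p] by (auto simp: atom_def)
qed

lemma bij_betw_comp_permutes_atom:
  assumes p: "p permutes {1..N}"
  shows "bij_betw (\<lambda>x. x \<circ> p) (atom X N m) (atom X N m)"
proof (rule bij_betw_byWitness[where f' = "\<lambda>x. x \<circ> inv p"])
  show "(\<lambda>x. x \<circ> inv p) ` atom X N m \<subseteq> atom X N m"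
    using comp_permutes_mem_atom[OF permutes_inv[OF p]] by auto
qed (auto simp: o_assoc[symmetric] permutes_inv_o[OF p] intro: comp_permutes_mem_atom[OF p])

text \<open>Members of one atom have the same multiset of values, and functions with equal image
  multisets differ by a permutation of the index set.\<close>

lemma atom_transitive:
  assumes x: "x \<in> atom X N m" and y: "y \<in> atom X N m"
  obtains p where "p permutes {1..N}" and "y = x \<circ> p"
proof -
  have "count (image_mset y (mset_set {1..N})) z = count (image_mset x (mset_set {1..N})) z" for z
  proof (cases "z \<in> X")
    case True
    then show ?thesis
      using x y by (simp add: count_image_mset atom_def vimage_def Int_def conj_commute)
  next
    case False
    \<comment> \<open>An atom prescribes counts only for \<open>z\<close> in \<open>X\<close>; other
      values do not occur in a sequence over \<open>X\<close>.\<close>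
    then have "y -` {z} \<inter> {1..N} = {}" "x -` {z} \<inter> {1..N} = {}"
      using x y by (auto simp: atom_def seqs_def)
    then show ?thesis
      by (simp add: count_image_mset)
  qed
  then have "image_mset y (mset_set {1..N}) = image_mset x (mset_set {1..N})"
    by (rule multiset_eqI)
  then obtain p where p: "p permutes {1..N}" and eq: "\<forall>k\<in>{1..N}. y k = x (p k)"
    using image_mset_eq_implies_permutes[of "{1..N}" y x] by blast
  have seq: "x \<in> seqs X N" "y \<in> seqs X N"
    using x y by (auto simp: atom_def)
  have "y k = (x \<circ> p) k" for k
  proof (cases "k \<in> {1..N}")
    \<comment> \<open>Off \<open>{1..N}\<close>, \<open>p\<close> fixes \<open>k\<close> and both
      sequences are \<open>undefined\<close>.\<close>
    case False
    then show ?thesis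
      using seq by (simp add: permutes_not_in[OF p False] seqs_undefined)
  qed (use eq in simp)
  then show thesis
    using that p by blast
qed

text \<open>Composition with \<open>q\<close> on the left permutes the index set of the sum, as
  \<open>(x \<circ> q) \<circ> p = x \<circ> (q \<circ> p)\<close>.\<close>

lemma ex_avg_comp_permutes:
  assumes "q permutes {1..N}"
  shows "ex_avg N f (x \<circ> q) = ex_avg N f x"
  using setum_permutations_compose_left[OF assms, of "\<lambda>p. f (x \<circ> p)"]
  by (simp add: ex_avg_def perm_gamble_def o_assoc)

text \<open>Once the sums are exchanged, each permutation merely reindexes the atom, which leaves
  \<open>fact N\<close> equal inner sums.\<close>

lemma sum_atom_ex_avg: "(\<Sum>y\<in>atom X N m. ex_avg N f y) = (\<Sum>y\<in>atom X N m. f y)"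
proof -
  have "(\<Sum>y\<in>atom X N m. ex_avg N f y)
      = 1 / fact N * (\<Sum>p | p permutes {1..N}. \<Sum>y\<in>atom X N m. f (y \<circ> p))"
    unfolding ex_avg_def perm_gamble_def sum_distrib_left[symmetric] by (subst sum.swap) simp
  also have "(\<Sum>p | p permutes {1..N}. \<Sum>y\<in>atom X N m. f (y \<circ> p))
      = (\<Sum>p | p permutes {1..N}. \<Sum>y\<in>atom X N m. f y)"
    by (rule sum.cong[OF refl], rule sum.reindex_bij_betw, rule bij_betw_comp_permutes_atom) simp
  also have "\<dots> = fact N * (\<Sum>y\<in>atom X N m. f y)"
    using card_permutations[OF refl, of "{1..N}"] by simp
  finally show ?thesis
    by simp
qed

text \<open>By transitivity and invariance \<open>ex_avg N f\<close> is constant on each atom and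
  has the same sum there as \<open>f\<close>, so its value is the mean of \<open>f\<close>.\<close>

lemma ex_avg_eq_lift_Hy:
  assumes fin: "finite X" and f: "f \<in> gambles (seqs X N)"
  shows "ex_avg N f = lift X N (Hy X N f)"
proof
  fix x
  show "ex_avg N f x = lift X N (Hy X N f) x"
  proof (cases "x \<in> seqs X N")
    case True
    let ?m = "count_of X N x"
    have x: "x \<in> atom X N ?m"
      using True by (rule mem_atom_count_of)
    have "ex_avg N f y = ex_avg N f x" if "y \<in> atom X N ?m" for y
      using atom_transitive[OF x that] ex_avg_comp_permutes by metis
    then have "(\<Sum>y\<in>atom X N ?m. f y) = card (atom X N ?m) * ex_avg N f x"
      using sum_atom_ex_avg[of N f X ?m] by simp
    moreover have "card (atom X N ?m) \<noteq> 0"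
      using x finite_atom[OF fin] by auto
    ultimately show ?thesis
      using True count_of_mem[OF fin True] by (simp add: lift_def Hy_def)
  next
    case False
    \<comment> \<open>Permuting keeps \<open>x\<close> outside \<open>seqs X N\<close>, where the
      gamble \<open>f\<close> vanishes.\<close>
    then have "f (x \<circ> p) = 0" if "p permutes {1..N}" for p
      using f comp_permutes_mem_seqs_iff[OF that, of x X] by (auto simp: gambles_def)
    then show ?thesis
      using False by (simp add: ex_avg_def perm_gamble_def lift_def)
  qed
qed

section \<open>The map \<open>Hy\<close> and its right inverse\<close>

lemma Hy_add: "Hy X N (f + g) = Hy X N f + Hy X N g"
  by (rule ext) (simp add: Hy_def sum.distrib add_divide_distrib)

lemma Hy_scale: "Hy X N (\<lambda>x. l * f x) = (\<lambda>m. l * Hy X N f m)"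
  by (rule ext) (simp add: Hy_def sum_distrib_left[symmetric])

lemma Hy_diff: "Hy X N (f - g) = Hy X N f - Hy X N g"
  by (rule ext) (simp add: Hy_def sum_subtractf diff_divide_distrib)

lemma Hy_zero [simp]: "Hy X N 0 = 0"
  by (rule ext) (simp add: Hy_def)

lemma Hy_sum: "Hy X N (\<lambda>x. \<Sum>k\<in>K. l k * f k x) = (\<lambda>m. \<Sum>k\<in>K. l k * Hy X N (f k) m)"
proof (induction K rule: infinite_finite_induct)
  case (insert k K)
  have "Hy X N ((\<lambda>x. l k * f k x) + (\<lambda>x. \<Sum>j\<in>K. l j * f j x))
      = (\<lambda>m. l k * Hy X N (f k) m) + (\<lambda>m. \<Sum>j\<in>K. l j * Hy X N (f j) m)"
    by (simp only: Hy_add Hy_scale insert.IH)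
  then show ?case
    using insert.hyps by (simp add: plus_fun_def)
qed (use Hy_zero in \<open>simp_all add: zero_fun_def\<close>)

lemma Hy_mono: "f \<le> g \<Longrightarrow> Hy X N f \<le> Hy X N g"
  by (auto simp: le_fun_def Hy_def intro!: divide_right_mono sum_mono)

text \<open>On a finite carrier the sum of all absolute values is a bound. Closure of
  \<open>gambles\<close> under linear operations then reduces to vanishing outside the
  carrier.\<close>

lemma gambles_finite: "finite \<Omega> \<Longrightarrow> gambles \<Omega> = {f. \<forall>w. w \<notin> \<Omega> \<longrightarrow> f w = 0}"
proof -
  assume "finite \<Omega>"
  then have "\<exists>B. \<forall>w\<in>\<Omega>. \<bar>f w\<bar> \<le> B" for f :: "'a \<Rightarrow> real"
    by (intro exI[of _ "\<Sum>w\<in>\<Omega>. \<bar>f w\<bar>"] ballI member_le_sum) auto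
  then show ?thesis
    by (simp add: gambles_def)
qed

text \<open>Atoms of count vectors are non-empty, so \<open>count_of\<close> maps the finite set of
  sequences onto them.\<close>

lemma finite_count_vectors:
  assumes "finite X"
  shows "finite (count_vectors X N)"
proof (rule finite_subset)
  show "finite (count_of X N ` seqs X N)"
    using assms by (simp add: finite_seqs)
  show "count_vectors X N \<subseteq> count_of X N ` seqs X N"
  proof
    fix m assume m: "m \<in> count_vectors X N"
    then obtain x where "x \<in> atom X N m"
      using atom_nonempty[OF assms] by blast
    then show "m \<in> count_of X N ` seqs X N"
      using count_of_atom[OF _ m] by (force simp: atom_def)
  qed
qed

lemma Hy_mem_gambles: "finite X \<Longrightarrow> Hy X N f \<in> gambles (count_vectors X N)"
  by (simp add: gambles_finite finite_count_vectors Hy_def)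

lemma lift_mem_gambles: "finite X \<Longrightarrow> lift X N g \<in> gambles (seqs X N)"
  by (simp add: gambles_finite finite_seqs lift_def)

text \<open>The lift equals \<open>g m\<close> throughout the non-empty atom of \<open>m\<close>,
  hence so does its mean.\<close>

lemma Hy_lift:
  assumes fin: "finite X" and g: "g \<in> gambles (count_vectors X N)"
  shows "Hy X N (lift X N g) = g"
proof
  fix m
  show "Hy X N (lift X N g) m = g m"
  proof (cases "m \<in> count_vectors X N")
    case True
    have "lift X N g y = g m" if "y \<in> atom X N m" for y
      using that count_of_atom[OF that True] by (simp add: lift_def atom_def)
    moreover have "card (atom X N m) \<noteq> 0"
      using atom_nonempty[OF fin True] finite_atom[OF fin] by auto
    ultimately show ?thesis
      using True by (simp add: Hy_def)
  next
    case False
    then show ?thesis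
      using g by (simp add: Hy_def gambles_def)
  qed
qed

text \<open>Since \<open>ex_avg\<close> is \<open>lift\<close> after \<open>Hy\<close>, and
  \<open>Hy\<close> undoes \<open>lift\<close>, the average vanishes exactly when
  \<open>Hy X N f\<close> does.\<close>

lemma DU_iff:
  assumes "finite X" and "f \<in> gambles (seqs X N)"
  shows "f \<in> DU X N \<longleftrightarrow> Hy X N f = 0"
proof -
  have "lift X N 0 = 0"
    by (rule ext) (simp add: lift_def)
  then have "lift X N (Hy X N f) = 0 \<longleftrightarrow> Hy X N f = 0"
    using Hy_lift[OF assms(1) Hy_mem_gambles[OF assms(1)]] by (metis Hy_zero)
  then show ?thesis
    using assms by (simp add: DU_def ex_avg_eq_lift_Hy)
qed

text \<open>Strictness survives averaging: a point where \<open>f\<close> is positive contributes to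
  the mean over its own finite atom, where no term is negative.\<close>

lemma Hy_pos:
  assumes fin: "finite X" and f: "f \<in> gambles (seqs X N)" and pos: "0 < f"
  shows "0 < Hy X N f"
proof -
  have nonneg: "0 \<le> f x" for x
    using pos by (simp add: less_fun_def le_fun_def)
  obtain x where x: "f x \<noteq> 0"
    using pos by (auto simp: less_fun_def le_fun_def) fastforce
  let ?m = "count_of X N x"
  have seq: "x \<in> seqs X N"
    using f x by (auto simp: gambles_def)
  have "0 < (\<Sum>y\<in>atom X N ?m. f y)"
    using finite_atom[OF fin] mem_atom_count_of[OF seq] nonneg x
    by (intro sum_pos2[where i = x]) (auto simp: less_le)
  moreover have "0 < card (atom X N ?m)"
    using mem_atom_count_of[OF seq] finite_atom[OF fin] by (auto simp: card_gt_0_iff)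
  ultimately have "0 < Hy X N f ?m"
    using count_of_mem[OF fin seq] by (simp add: Hy_def)
  moreover have "0 \<le> Hy X N f"
    using Hy_mono[of 0 f X N] nonneg by (simp add: le_fun_def)
  ultimately show ?thesis
    by (auto simp: less_fun_def le_fun_def not_le)
qed

lemma lift_pos:
  assumes fin: "finite X" and g: "g \<in> gambles (count_vectors X N)" and pos: "0 < g"
  shows "0 < lift X N g"
proof -
  have "0 \<le> lift X N g"
    using pos by (simp add: less_fun_def le_fun_def lift_def)
  moreover have "lift X N g \<noteq> 0"
    using Hy_lift[OF fin g] pos by (metis Hy_zero less_irrefl)
  ultimately show ?thesis
    by simp
qed

section \<open>Avoiding non-positivity\<close>

text \<open>An enumeration of \<open>K\<close> turns the sum into one over \<open>{1..n}\<close>,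
  the only index sets in the definition of \<open>posi\<close>.\<close>

lemma sum_mem_posi:
  assumes "finite K" and "K \<noteq> {}" and "\<And>k. k \<in> K \<Longrightarrow> f k \<in> A" and "\<And>k. k \<in> K \<Longrightarrow> l k > 0"
  shows "(\<lambda>w. \<Sum>k\<in>K. l k * f k w) \<in> posi A"
proof -
  obtain h where h: "bij_betw h {1..card K} K"
    using ex_bij_betw_nat_finite_1[OF assms(1)] by blast
  have "(\<lambda>w. \<Sum>k\<in>K. l k * f k w) = (\<lambda>w. \<Sum>j=1..card K. l (h j) * f (h j) w)"
    using sum.reindex_bij_betw[OF h, of "\<lambda>k. l k * f k w" for w] by simp
  moreover have "1 \<le> card K"
    using assms(1,2) by (simp add: Suc_le_eq card_gt_0_iff)
  ultimately show ?thesis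
    unfolding posi_def using bij_betwE[OF h] assms(3,4)
    by (intro CollectI exI[of _ "card K"] exI[of _ "l \<circ> h"] exI[of _ "f \<circ> h"]) auto
qed

text \<open>A non-positive combination of images lifts to a non-positive combination of sequence
  gambles. Each lifted term \<open>lift X N (Hy X N a)\<close> differs from \<open>a\<close> by an
  element of the kernel, so it lies in \<open>A + DU X N\<close>.\<close>

lemma avoids_nonpositivity_ex_imp_Hy:
  assumes fin: "finite X" and A: "A \<subseteq> gambles (seqs X N)"
    and av: "avoids_nonpositivity_ex X N A"
  shows "avoids_nonpositivity (Hy X N ` A)"
  unfolding avoids_nonpositivity_def
proof (rule notI, elim bexE)
  fix w assume "w \<in> posi (Hy X N ` A)" and le: "w \<le> 0"
  then obtain n l h where w: "w = (\<lambda>m. \<Sum>k=1..n. l k * h k m)" and n: "n \<ge> (1::nat)"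
    and h: "\<And>k. k \<in> {1..n} \<Longrightarrow> h k \<in> Hy X N ` A" and l: "\<And>k. k \<in> {1..n} \<Longrightarrow> l k > (0::real)"
    unfolding posi_def by blast
  have "lift X N (h k) \<in> (pos_gambles (seqs X N) \<union> A) + DU X N" if k: "k \<in> {1..n}" for k
  proof -
    obtain a where a: "a \<in> A" and hk: "h k = Hy X N a"
      using h[OF k] by blast
    have "lift X N (h k) - a \<in> gambles (seqs X N)"
      using a A lift_mem_gambles[OF fin, of N "h k"] by (auto simp: gambles_finite finite_seqs fin)
    moreover have "Hy X N (lift X N (h k) - a) = 0"
      by (simp add: hk Hy_diff Hy_lift[OF fin Hy_mem_gambles[OF fin]])
    ultimately have "lift X N (h k) - a \<in> DU X N"
      using DU_iff[OF fin] by blast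
    then have "a + (lift X N (h k) - a) \<in> (pos_gambles (seqs X N) \<union> A) + DU X N"
      using a by (intro set_plus_intro) auto
    then show ?thesis
      by simp
  qed
  then have "(\<lambda>x. \<Sum>k=1..n. l k * lift X N (h k) x) \<in> posi ((pos_gambles (seqs X N) \<union> A) + DU X N)"
    using n l by (intro sum_mem_posi) auto
  moreover have "(\<lambda>x. \<Sum>k=1..n. l k * lift X N (h k) x) \<le> 0"
  proof (rule le_funI)
    fix x
    show "(\<Sum>k=1..n. l k * lift X N (h k) x) \<le> 0 x"
      using le by (cases "x \<in> seqs X N") (simp_all add: le_fun_def w lift_def)
  qed
  ultimately show False
    using av by (auto simp: avoids_nonpositivity_ex_def avoids_nonpositivity_def)
qed

lemma Hy_imp_avoids_nonpositivity_ex: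
  assumes fin: "finite X" and av: "avoids_nonpositivity (Hy X N ` A)"
  shows "avoids_nonpositivity_ex X N A"
  unfolding avoids_nonpositivity_ex_def avoids_nonpositivity_def
proof (rule notI, elim bexE)
  fix w assume "w \<in> posi ((pos_gambles (seqs X N) \<union> A) + DU X N)" and le: "w \<le> 0"
  then obtain n l f where w: "w = (\<lambda>x. \<Sum>k=1..n. l k * f k x)" and n: "n \<ge> (1::nat)"
    and f: "\<And>k. k \<in> {1..n} \<Longrightarrow> f k \<in> (pos_gambles (seqs X N) \<union> A) + DU X N"
    and l: "\<And>k. k \<in> {1..n} \<Longrightarrow> l k > (0::real)"
    unfolding posi_def by blast
  let ?h = "\<lambda>k. Hy X N (f k)"
  \<comment> \<open>Sorting indices by their images avoids choosing a decomposition of each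
    \<open>f k\<close>.\<close>
  define K where "K = {k \<in> {1..n}. ?h k \<in> Hy X N ` A}"
  have K: "finite K" "K \<subseteq> {1..n}"
    by (auto simp: K_def)
  have pos: "0 < ?h k" if k: "k \<in> {1..n} - K" for k
  proof -
    have "f k \<in> (pos_gambles (seqs X N) \<union> A) + DU X N"
      using f k by simp
    then obtain a d where a: "a \<in> pos_gambles (seqs X N) \<union> A" and d: "d \<in> DU X N"
      and fk: "f k = a + d"
      by (rule set_plus_elim)
    have "Hy X N d = 0"
      using d DU_iff[OF fin, of d N] by (simp add: DU_def)
    then have hk: "?h k = Hy X N a"
      by (simp add: fk Hy_add)
    \<comment> \<open>If \<open>a\<close> were in \<open>A\<close>, its image would place
      \<open>k\<close> in \<open>K\<close>.\<close>
    then have "a \<in> pos_gambles (seqs X N)"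
      using a k by (auto simp: K_def)
    then show ?thesis
      using hk Hy_pos[OF fin] by (simp add: pos_gambles_def)
  qed
  have total: "(\<Sum>k=1..n. l k * ?h k m) \<le> 0" for m
    using Hy_mono[OF le, of X N] by (simp add: w Hy_sum le_fun_def)
  have nonneg: "0 \<le> l k * ?h k m" if "k \<in> {1..n} - K" for k m
    using pos[OF that] l[of k] that by (auto simp: less_fun_def le_fun_def)
  show False
  \<comment> \<open>With no index left, discarding would give an empty sum, which
    \<open>posi\<close> does not admit. In that case every term is positive, and
    \<open>n \<ge> 1\<close> supplies one.\<close>
  proof (cases "K = {}")
    case True
    have 1: "1 \<in> {1..n} - K"
      using n True by simp
    obtain m where "?h 1 m > 0"
      using pos[OF 1] by (auto simp: less_fun_def le_fun_def not_le)
    then have "0 < l 1 * ?h 1 m"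
      using l[of 1] n by simp
    then have "0 < (\<Sum>k=1..n. l k * ?h k m)"
      using nonneg True 1 by (intro sum_pos2[where i = 1]) auto
    then show False
      using total[of m] by simp
  next
    case False
    have "(\<lambda>m. \<Sum>k\<in>K. l k * ?h k m) \<in> posi (Hy X N ` A)"
      using K False l by (intro sum_mem_posi) (auto simp: K_def)
    \<comment> \<open>The omitted terms are nonnegative, so the partial sum is at most the full
      one.\<close>
    moreover have "(\<Sum>k\<in>K. l k * ?h k m) \<le> 0" for m
      using sum_mono2[of "{1..n}" K "\<lambda>k. l k * ?h k m"] K nonneg total[of m] by fastforce
    ultimately show False
      using av by (auto simp: avoids_nonpositivity_def le_fun_def)
  qed
qed

section \<open>Coherence and exchangeability\<close>

lemma coherent_Hy_preimage:
  assumes fin: "finite X" and S: "coherent (count_vectors X N) S"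
  shows "coherent (seqs X N) {f \<in> gambles (seqs X N). Hy X N f \<in> S}"
  using S unfolding coherent_def
  by (auto simp: Hy_add Hy_scale Hy_pos[OF fin] Hy_mem_gambles[OF fin])
     (auto simp: gambles_finite finite_seqs[OF fin])

lemma exchangeable_Hy_preimage:
  assumes fin: "finite X"
  shows "exchangeable X N {f \<in> gambles (seqs X N). Hy X N f \<in> S}"
  unfolding exchangeable_def
proof
  fix h assume "h \<in> DU X N + {f \<in> gambles (seqs X N). Hy X N f \<in> S}"
  then obtain d f where "d \<in> DU X N" "f \<in> gambles (seqs X N)" "Hy X N f \<in> S" "h = d + f"
    by (blast elim: set_plus_elim)
  then show "h \<in> {f \<in> gambles (seqs X N). Hy X N f \<in> S}"
    using DU_iff[OF fin, of d N] by (auto simp: Hy_add DU_def gambles_finite finite_seqs[OF fin])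
qed

text \<open>Within the gambles, an exchangeable set is a union of fibres of \<open>Hy\<close>: the
  difference \<open>h - f\<close> lies in the kernel \<open>DU X N\<close>, and adding it to
  \<open>f\<close> stays in \<open>R\<close>.\<close>

lemma exchangeable_Hy_eq:
  assumes fin: "finite X" and ex: "exchangeable X N R"
    and f: "f \<in> R" "f \<in> gambles (seqs X N)" and h: "h \<in> gambles (seqs X N)"
    and eq: "Hy X N h = Hy X N f"
  shows "h \<in> R"
proof -
  have "h - f \<in> gambles (seqs X N)"
    using f h by (simp add: gambles_finite finite_seqs[OF fin])
  then have "h - f \<in> DU X N"
    using DU_iff[OF fin] eq by (simp add: Hy_diff)
  then have "(h - f) + f \<in> DU X N + R"
    using f by (intro set_plus_intro)
  then show ?thesis
    using ex by (auto simp: exchangeable_def)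
qed

text \<open>Linearity transfers the closure axioms, and a positive \<open>g\<close> is the image of
  its positive lift. Exchangeability excludes 0: an element of \<open>R\<close> with image 0 would
  share its fibre with 0 and force \<open>0 \<in> R\<close>.\<close>

lemma coherent_Hy_image:
  assumes fin: "finite X" and R: "coherent (seqs X N) R" and ex: "exchangeable X N R"
  shows "coherent (count_vectors X N) (Hy X N ` R)"
  unfolding coherent_def
proof (intro conjI ballI allI impI)
  show "Hy X N ` R \<subseteq> gambles (count_vectors X N)"
    using Hy_mem_gambles[OF fin] by auto
  show "0 \<notin> Hy X N ` R"
  proof
    assume "0 \<in> Hy X N ` R"
    then obtain f where f: "f \<in> R" "Hy X N f = 0"
      by auto
    have "0 \<in> R"
      using f R by (intro exchangeable_Hy_eq[OF fin ex f(1)]) (auto simp: coherent_def gambles_def)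
    then show False
      using R by (simp add: coherent_def)
  qed
  show "g \<in> Hy X N ` R" if "g \<in> gambles (count_vectors X N)" "0 < g" for g
  proof (rule image_eqI)
    show "g = Hy X N (lift X N g)"
      using Hy_lift[OF fin that(1)] by simp
    show "lift X N g \<in> R"
      using R lift_pos[OF fin that] lift_mem_gambles[OF fin] by (auto simp: coherent_def)
  qed
  show "(\<lambda>m. l * g m) \<in> Hy X N ` R" if g: "g \<in> Hy X N ` R" and l: "l > 0" for g l
  proof -
    obtain f where f: "f \<in> R" "g = Hy X N f"
      using g by auto
    then have "(\<lambda>x. l * f x) \<in> R"
      using R l by (simp add: coherent_def)
    then have "Hy X N (\<lambda>x. l * f x) \<in> Hy X N ` R"
      by (rule imageI)
    then show ?thesis
      by (simp add: Hy_scale f(2))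
  qed
  show "g + h \<in> Hy X N ` R" if "g \<in> Hy X N ` R" "h \<in> Hy X N ` R" for g h
    using that R by (auto simp: coherent_def Hy_add[symmetric])
qed

text \<open>Preimages of coherent sets are among the sets intersected on the left, images of
  coherent exchangeable sets among those on the right; each fact gives one inclusion.\<close>

lemma Hy_ex_natural_extension:
  assumes fin: "finite X" and A: "A \<subseteq> gambles (seqs X N)"
  shows "Hy X N ` ex_natural_extension X N A = natural_extension (count_vectors X N) (Hy X N ` A)"
proof (intro equalityI subsetI)
  fix g assume "g \<in> Hy X N ` ex_natural_extension X N A"
  then obtain f where f: "f \<in> ex_natural_extension X N A" and g: "g = Hy X N f"
    by auto
  have "g \<in> S" if S: "coherent (count_vectors X N) S" "Hy X N ` A \<subseteq> S" for S
  proof -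
    have "A \<subseteq> {f \<in> gambles (seqs X N). Hy X N f \<in> S}"
      using A S(2) by auto
    then have "f \<in> {f \<in> gambles (seqs X N). Hy X N f \<in> S}"
      using f coherent_Hy_preimage[OF fin S(1)] exchangeable_Hy_preimage[OF fin, of N S]
      unfolding ex_natural_extension_def by blast
    then show ?thesis
      by (simp add: g)
  qed
  \<comment> \<open>Membership in the space of gambles is shown separately; it settles the case of
    an empty family.\<close>
  then show "g \<in> natural_extension (count_vectors X N) (Hy X N ` A)"
    using Hy_mem_gambles[OF fin] by (auto simp: natural_extension_def g)
next
  fix g assume g: "g \<in> natural_extension (count_vectors X N) (Hy X N ` A)"
  then have Hg: "Hy X N (lift X N g) = g"
    by (intro Hy_lift[OF fin]) (simp add: natural_extension_def)
  \<comment> \<open>The preimage \<open>f\<close> of \<open>g\<close> found in \<open>R\<close>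
    depends on \<open>R\<close>, whereas \<open>lift X N g\<close> lies in the same fibre for every
    \<open>R\<close> and so serves as a common witness.\<close>
  have "lift X N g \<in> R"
    if R: "coherent (seqs X N) R" "exchangeable X N R" "A \<subseteq> R" for R
  proof -
    have "g \<in> Hy X N ` R"
      using g coherent_Hy_image[OF fin R(1,2)] image_mono[OF R(3), of "Hy X N"]
      unfolding natural_extension_def by blast
    then obtain f where f: "f \<in> R" "g = Hy X N f"
      by auto
    then show ?thesis
      using R(1) lift_mem_gambles[OF fin] Hg
      by (intro exchangeable_Hy_eq[OF fin R(2) f(1)]) (auto simp: coherent_def)
  qed
  then have "lift X N g \<in> ex_natural_extension X N A"
    using lift_mem_gambles[OF fin] by (auto simp: ex_natural_extension_def)
  then show "g \<in> Hy X N ` ex_natural_extension X N A"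
    using Hg by (metis imageI)
qed

theorem theorem19:
  fixes X :: "'a set" and N :: nat and A :: "((nat \<Rightarrow> 'a) \<Rightarrow> real) set"
  assumes "finite X" and "X \<noteq> {}" and "N \<ge> 1"
    and "A \<subseteq> gambles (seqs X N)"
  shows "(avoids_nonpositivity_ex X N A \<longleftrightarrow> avoids_nonpositivity (Hy X N ` A)) \<and>
    Hy X N ` ex_natural_extension X N A = natural_extension (count_vectors X N) (Hy X N ` A)"
  using avoids_nonpositivity_ex_imp_Hy[OF assms(1,4)] Hy_imp_avoids_nonpositivity_ex[OF assms(1)]
    Hy_ex_natural_extension[OF assms(1,4)]
  by blast

end
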